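(* Let $G=(V,E)$ be a DAG containing no active cycles and no interfering v-structures. The joint density of any PCBN with DAG $G$ does not require integration if and only if its set of parental orders $O=(<_v)_{v\in V}$ is one of the possible outputs of the order-finding algorithm described in the context.
   Context: Graphs. $G=(V,E)$ is a finite directed acyclic graph (DAG) without loops or multiple arcs. $w\to v$ means that the arc from $w$ to $v$ is in $E$; then $w$ is a parent of $v$ and $v$ a child of $w$. $pa(v)$ and $de(v)$ are the sets of parents and descendants of $v$ (nodes reachable from $v$ by a directed path). Two nodes are adjacent if there is an arc between them in some direction. A trail $v_1\rightleftharpoons\cdots\rightleftharpoons v_n$ is a sequence of distinct nodes whose consecutive nodes are adjacent. It has a converging connection (v-structure) at $v_i$ ($1<i<n$) if $v_{i-1}\to v_i\leftarrow v_{i+1}$; otherwise the connection at $v_i$ is serial or diverging. A chord of a (possibly closed) trail is an arc between two non-consecutive nodes of it. For disjoint $S,Y,Z\subseteq V$, a trail from $S$ to $Y$ is blocked by $Z$ if it contains a node $v_i$ such that either the trail has a converging connection at $v_i$ and $\{v_i\}\cup de(v_i)$ is disjoint from $Z$, or the trail has no converging connection at $v_i$ and $v_i\in Z$; otherwise it is activated by $Z$. $\mathrm{dsep}(S,Y|Z)$ means that every trail from a node of $S$ to a node of $Y$ is blocked by $Z$; it holds by convention if $S$ or $Y$ is empty. Braces around singletons are omitted. Active cycle. $G$ contains an active cycle if there are a node $v$, distinct parents $w,z\in pa(v)$ and a trail $w\rightleftharpoons x_1\rightleftharpoons\cdots\rightleftharpoons x_n\rightleftharpoons z$ with $n\ge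 1$, having only serial or diverging connections, such that the closed trail $v\leftarrow w\rightleftharpoons x_1\rightleftharpoons\cdots\rightleftharpoons x_n\rightleftharpoons z\to v$ has no chords. Interfering v-structures. $G$ contains interfering v-structures if there are nodes $v_1,\dots,v_5\in V$ with $v_3\to v_4$, $v_3\to v_5$, $v_1\to v_3$, $v_1\to v_4$, $v_1\not\to v_5$, $v_2\to v_3$, $v_2\to v_5$, $v_2\not\to v_4$. PCBN. A parental order $<_v$ is a total order on $pa(v)$; for $w\in pa(v)$, $pa(v\downarrow w)=\{z\in pa(v): z<_v w\}$. A pair-copula Bayesian network (PCBN) has a structure $(G,O)$, $O=(<_v)_{v\in V}$, arbitrary univariate densities $(f_v)_{v\in V}$, and arbitrary bivariate (conditional) copulas $C_{w,v|pa(v\downarrow w)}$, one for each arc $w\to v$. Its joint density is the product of the marginal densities and of the joint copula density $c(\mathbf u)=\prod_{v\in V}\prod_{w\in pa(v)} c_{w,v|pa(v\downarrow w)}(u_{w|pa(v\downarrow w)},u_{v|pa(v\downarrow w)}\,|\,\mathbf u_{pa(v\downarrow w)})$, where $u_{v|S}=\mathbb P(U_v\le u_v|\mathbf U_S=\mathbf u_S)$ (a "conditional margin"). Specified copulas. For distinct $w,v\in V$ and $K\subseteq V\setminus\{w,v\}$, the copula $C_{w,v|K}$ (identified with $C_{v,w|K}$) is specified if, for one of the two ways of naming the pair, one of the following holds: (i) $w\to v$ and $K=pa(v\downarrow w)$; (ii) $\mathrm{dsep}(w,v|K)$; (iii) $w\to v$ and $K=pa(v\downarrow w)\sqcup J$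 with $J\ne\emptyset$ and $\mathrm{dsep}(v,J\,|\,pa(v\downarrow w)\sqcup\{w\})$. Recursions. For $v\in V$, $K\subseteq V\setminus\{v\}$, the set of recursions $\mathcal R(v|K)$ is defined by $\mathcal R(v|\emptyset)=\{u_v\}$ and $\mathcal R(v|K)=\bigsqcup_{k\in K}\{(u_{v|K},k,C_{v,k|K\setminus k},R_v,R_k): R_v\in\mathcal R(v|K\setminus k),\ R_k\in\mathcal R(k|K\setminus k)\}$. A recursion is proper if all copulas appearing in it (including recursively in $R_v,R_k$) are specified. $u_{v|K}$ does not require integration (can be computed without integration) if there is a proper recursion in $\mathcal R(v|K)$; otherwise it requires integration. The joint density does not require integration if none of the conditional margins $u_{w|pa(v\downarrow w)}$, $u_{v|pa(v\downarrow w)}$ ($v\in V$, $w\in pa(v)$) appearing in the factorization of $c$ requires integration; otherwise it requires integration. Algorithm. A partial order $O_v^k=(o_1,\dots,o_k)$ is an ordered subset of $k$ parents of $v$ (also regarded as a set), read as $o_1<_v\cdots<_v o_k$. For $k<|pa(v)|$, the set of possible candidates $PossCand(O_v^k)$ is the set of all $w\in pa(v)$ (not already in $O_v^k$) such that $u_{w|O_v^k}$ can be computed without integration. The algorithm takes as input a DAG with no active cycles and no interfering v-structures and goes through the nodes $v\in V$ along a well-ordering of $V$ (i.e. a topological order: parents precede children), so that when $v$ is reached the parental orders of all nodes in $pa(v)$ have already been chosen. For each $v$ it starts with $O_v^0=\emptyset$ and, for $k=0,\dots,|pa(v)|-1$, computes $PossCand(O_v^k)$, chooses one element $w\in PossCand(O_v^k)$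 and sets $O_v^{k+1}=(O_v^k,w)$; then $<_v$ is the order given by $O_v^{|pa(v)|}$. It returns $O=(<_v)_{v\in V}$. The possible outputs are the collections obtainable by some sequence of choices. *)

theory Defs
  imports "HOL-Probability.Probability"
begin

section \<open>Directed acyclic graphs\<close>

definition dag :: "'a set \<Rightarrow> ('a \<times> 'a) set \<Rightarrow> bool" where
  "dag V E \<longleftrightarrow> finite V \<and> E \<subseteq> V \<times> V \<and> acyclic E"

definition pa :: "('a \<times> 'a) set \<Rightarrow> 'a \<Rightarrow> 'a set" where
  "pa E v = {w. (w, v) \<in> E}"

definition de :: "('a \<times> 'a) set \<Rightarrow> 'a \<Rightarrow> 'a set" where
  "de E v = {y. (v, y) \<in> E\<^sup>+}"

definition adjacent :: "('a \<times> 'a) set \<Rightarrow> 'a \<Rightarrow> 'a \<Rightarrow> bool" where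
  "adjacent E x y \<longleftrightarrow> (x, y) \<in> E \<or> (y, x) \<in> E"

definition trail :: "'a set \<Rightarrow> ('a \<times> 'a) set \<Rightarrow> 'a list \<Rightarrow> bool" where
  "trail V E xs \<longleftrightarrow> xs \<noteq> [] \<and> set xs \<subseteq> V \<and> distinct xs \<and>
     (\<forall>i. Suc i < length xs \<longrightarrow> adjacent E (xs ! i) (xs ! Suc i))"

definition converging_at :: "('a \<times> 'a) set \<Rightarrow> 'a list \<Rightarrow> nat \<Rightarrow> bool" where
  "converging_at E xs i \<longleftrightarrow> 0 < i \<and> Suc i < length xs \<and>
     (xs ! (i - 1), xs ! i) \<in> E \<and> (xs ! Suc i, xs ! i) \<in> E"

definition blocked :: "('a \<times> 'a) set \<Rightarrow> 'a set \<Rightarrow> 'a list \<Rightarrow> bool" where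
  "blocked E Z xs \<longleftrightarrow> (\<exists>i < length xs.
     (converging_at E xs i \<and> ({xs ! i} \<union> de E (xs ! i)) \<inter> Z = {}) \<or>
     (\<not> converging_at E xs i \<and> xs ! i \<in> Z))"

text \<open>Only used for pairwise disjoint \<open>S\<close>, \<open>Y\<close>, \<open>Z\<close>; it holds vacuously if \<open>S\<close> or \<open>Y\<close> is empty.\<close>

definition dsep :: "'a set \<Rightarrow> ('a \<times> 'a) set \<Rightarrow> 'a set \<Rightarrow> 'a set \<Rightarrow> 'a set \<Rightarrow> bool" where
  "dsep V E S Y Z \<longleftrightarrow>
     (\<forall>xs. trail V E xs \<and> hd xs \<in> S \<and> last xs \<in> Y \<longrightarrow> blocked E Z xs)"

text \<open>Chords of the closed trail that runs through \<open>ys\<close> and returns from its last to its first node.\<close>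

definition closed_trail_has_chord :: "('a \<times> 'a) set \<Rightarrow> 'a list \<Rightarrow> bool" where
  "closed_trail_has_chord E ys \<longleftrightarrow> (\<exists>i < length ys. \<exists>j < length ys.
     i \<noteq> j \<and> j \<noteq> Suc i mod length ys \<and> i \<noteq> Suc j mod length ys \<and> (ys ! i, ys ! j) \<in> E)"

definition has_active_cycle :: "'a set \<Rightarrow> ('a \<times> 'a) set \<Rightarrow> bool" where
  "has_active_cycle V E \<longleftrightarrow> (\<exists>v \<in> V. \<exists>w \<in> pa E v. \<exists>z \<in> pa E v. \<exists>xs.
     w \<noteq> z \<and> xs \<noteq> [] \<and> trail V E (w # xs @ [z]) \<and> v \<notin> set (w # xs @ [z]) \<and>
     (\<forall>i. \<not> converging_at E (w # xs @ [z]) i) \<and>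
     \<not> closed_trail_has_chord E (v # w # xs @ [z]))"

definition has_interfering_v_structures :: "'a set \<Rightarrow> ('a \<times> 'a) set \<Rightarrow> bool" where
  "has_interfering_v_structures V E \<longleftrightarrow>
     (\<exists>v1 \<in> V. \<exists>v2 \<in> V. \<exists>v3 \<in> V. \<exists>v4 \<in> V. \<exists>v5 \<in> V.
        (v3, v4) \<in> E \<and> (v3, v5) \<in> E \<and>
        (v1, v3) \<in> E \<and> (v1, v4) \<in> E \<and> (v1, v5) \<notin> E \<and>
        (v2, v3) \<in> E \<and> (v2, v5) \<in> E \<and> (v2, v4) \<notin> E)"

section \<open>Pair-copula Bayesian networks\<close>

text \<open>A family of parental orders: \<open>(z, w) \<in> ords v\<close> means \<open>z <\<^sub>v w\<close>. Families are
  functions on \<open>V\<close>, hence extensional (\<open>undefined\<close> outside \<open>V\<close>).\<close>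

definition parental_orders :: "'a set \<Rightarrow> ('a \<times> 'a) set \<Rightarrow> ('a \<Rightarrow> 'a rel) set" where
  "parental_orders V E =
     (\<Pi>\<^sub>E v\<in>V. {r. r \<subseteq> pa E v \<times> pa E v \<and> strict_linear_order_on (pa E v) r})"

definition pa_below :: "('a \<times> 'a) set \<Rightarrow> ('a \<Rightarrow> 'a rel) \<Rightarrow> 'a \<Rightarrow> 'a \<Rightarrow> 'a set" where
  "pa_below E ords v w = {z \<in> pa E v. (z, w) \<in> ords v}"

definition uniform01 :: "real measure" where
  "uniform01 = uniform_measure lborel {0..1}"

definition univariate_density :: "(real \<Rightarrow> real) \<Rightarrow> bool" where
  "univariate_density f \<longleftrightarrow>
     f \<in> borel_measurable borel \<and> (\<forall>x. 0 \<le> f x) \<and> (\<integral>\<^sup>+x. ennreal (f x) \<partial>lborel) = 1"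

text \<open>The density of a bivariate copula, i.e. of a distribution on the unit square with
  uniform margins.\<close>

definition copula_density :: "(real \<times> real \<Rightarrow> real) \<Rightarrow> bool" where
  "copula_density c \<longleftrightarrow>
     c \<in> borel_measurable borel \<and> (\<forall>p. 0 \<le> c p) \<and>
     (let M = density (uniform01 \<Otimes>\<^sub>M uniform01) (\<lambda>p. ennreal (c p)) in
        distr M borel fst = uniform01 \<and> distr M borel snd = uniform01)"

text \<open>The copula \<open>C\<^bsub>w,v|pa(v\<down>w)\<^esub>\<close> is given through its density: \<open>pair_copula P w v x\<close> is the copula
  density given that \<open>U\<close> takes the value \<open>x\<close> on \<open>pa(v\<down>w)\<close>.\<close>

record 'a pcbn_data =
  orders :: "'a \<Rightarrow> 'a rel"
  marginal :: "'a \<Rightarrow> real \<Rightarrow> real"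
  pair_copula :: "'a \<Rightarrow> 'a \<Rightarrow> ('a \<Rightarrow> real) \<Rightarrow> real \<times> real \<Rightarrow> real"

definition pcbn :: "'a set \<Rightarrow> ('a \<times> 'a) set \<Rightarrow> 'a pcbn_data \<Rightarrow> bool" where
  "pcbn V E P \<longleftrightarrow>
     orders P \<in> parental_orders V E \<and>
     (\<forall>v \<in> V. univariate_density (marginal P v)) \<and>
     (\<forall>v \<in> V. \<forall>w \<in> pa E v.
        let B = Pi\<^sub>M (pa_below E (orders P) v w) (\<lambda>_. borel) in
          (\<lambda>(x, p). pair_copula P w v x p) \<in> borel_measurable (B \<Otimes>\<^sub>M borel) \<and>
          (\<forall>x \<in> space B. copula_density (pair_copula P w v x)))"

section \<open>Specified copulas and recursions\<close>

definition specified_directed ::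
    "'a set \<Rightarrow> ('a \<times> 'a) set \<Rightarrow> ('a \<Rightarrow> 'a rel) \<Rightarrow> 'a \<Rightarrow> 'a \<Rightarrow> 'a set \<Rightarrow> bool" where
  "specified_directed V E ords w v K \<longleftrightarrow>
     ((w, v) \<in> E \<and> K = pa_below E ords v w) \<or>
     dsep V E {w} {v} K \<or>
     ((w, v) \<in> E \<and>
       (\<exists>J. J \<noteq> {} \<and> J \<inter> pa_below E ords v w = {} \<and> K = pa_below E ords v w \<union> J \<and>
            dsep V E {v} J (pa_below E ords v w \<union> {w})))"

definition specified ::
    "'a set \<Rightarrow> ('a \<times> 'a) set \<Rightarrow> ('a \<Rightarrow> 'a rel) \<Rightarrow> 'a \<Rightarrow> 'a \<Rightarrow> 'a set \<Rightarrow> bool" where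
  "specified V E ords w v K \<longleftrightarrow>
     w \<in> V \<and> v \<in> V \<and> w \<noteq> v \<and> K \<subseteq> V - {w, v} \<and>
     (specified_directed V E ords w v K \<or> specified_directed V E ords v w K)"

text \<open>\<open>Base v\<close> stands for \<open>u\<^sub>v\<close>; \<open>Step (v, K) k (v, k, K - {k}) Rv Rk\<close> stands for the tuple
  \<open>(u\<^bsub>v|K\<^esub>, k, C\<^bsub>v,k|K-k\<^esub>, Rv, Rk)\<close>.\<close>

datatype 'a recursion =
    Base 'a
  | Step "'a \<times> 'a set" 'a "'a \<times> 'a \<times> 'a set" "'a recursion" "'a recursion"

inductive is_recursion :: "'a \<Rightarrow> 'a set \<Rightarrow> 'a recursion \<Rightarrow> bool" where
  base: "is_recursion v {} (Base v)"
| step: "k \<in> K \<Longrightarrow> is_recursion v (K - {k}) Rv \<Longrightarrow> is_recursion k (K - {k}) Rk \<Longrightarrow>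
         is_recursion v K (Step (v, K) k (v, k, K - {k}) Rv Rk)"

definition recursions :: "'a \<Rightarrow> 'a set \<Rightarrow> 'a recursion set" where
  "recursions v K = {R. is_recursion v K R}"

primrec copulas :: "'a recursion \<Rightarrow> ('a \<times> 'a \<times> 'a set) set" where
  "copulas (Base v) = {}"
| "copulas (Step m k C Rv Rk) = {C} \<union> copulas Rv \<union> copulas Rk"

definition proper ::
    "'a set \<Rightarrow> ('a \<times> 'a) set \<Rightarrow> ('a \<Rightarrow> 'a rel) \<Rightarrow> 'a recursion \<Rightarrow> bool" where
  "proper V E ords R \<longleftrightarrow> (\<forall>(w, v, K) \<in> copulas R. specified V E ords w v K)"

definition margin_requires_integration ::
    "'a set \<Rightarrow> ('a \<times> 'a) set \<Rightarrow> ('a \<Rightarrow> 'a rel) \<Rightarrow> 'a \<Rightarrow> 'a set \<Rightarrow> bool" where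
  "margin_requires_integration V E ords v K \<longleftrightarrow>
     \<not> (\<exists>R \<in> recursions v K. proper V E ords R)"

text \<open>Whether the joint density requires integration depends only on the structure of the PCBN:
  it concerns the symbols \<open>u\<^bsub>w|pa(v\<down>w)\<^esub>\<close>, \<open>u\<^bsub>v|pa(v\<down>w)\<^esub>\<close> in the factorization of the copula density
  into the pair-copula densities of all arcs \<open>w \<rightarrow> v\<close>.\<close>

definition joint_density_requires_integration ::
    "'a set \<Rightarrow> ('a \<times> 'a) set \<Rightarrow> 'a pcbn_data \<Rightarrow> bool" where
  "joint_density_requires_integration V E P \<longleftrightarrow>
     (\<exists>v \<in> V. \<exists>w \<in> pa E v.
        margin_requires_integration V E (orders P) w (pa_below E (orders P) v w) \<or>
        margin_requires_integration V E (orders P) v (pa_below E (orders P) v w))"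

section \<open>The order-finding algorithm\<close>

text \<open>Partial orders \<open>O\<^sub>v\<^sup>k\<close> are lists, smallest parent first.\<close>

definition poss_cand ::
    "'a set \<Rightarrow> ('a \<times> 'a) set \<Rightarrow> ('a \<Rightarrow> 'a rel) \<Rightarrow> 'a \<Rightarrow> 'a list \<Rightarrow> 'a set" where
  "poss_cand V E ords v os =
     {w \<in> pa E v - set os. \<not> margin_requires_integration V E ords w (set os)}"

inductive partial_order_reachable ::
    "'a set \<Rightarrow> ('a \<times> 'a) set \<Rightarrow> ('a \<Rightarrow> 'a rel) \<Rightarrow> 'a \<Rightarrow> 'a list \<Rightarrow> bool"
  for V E ords v where
  start: "partial_order_reachable V E ords v []"
| extend: "partial_order_reachable V E ords v os \<Longrightarrow> length os < card (pa E v) \<Longrightarrow>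
           w \<in> poss_cand V E ords v os \<Longrightarrow> partial_order_reachable V E ords v (os @ [w])"

definition order_of_list :: "'a list \<Rightarrow> 'a rel" where
  "order_of_list os = {(os ! i, os ! j) | i j. i < j \<and> j < length os}"

text \<open>\<open>algorithm_state V E vs ords\<close>: having gone through the nodes \<open>vs\<close>, in this order and parents
  before children, the algorithm can have chosen the parental orders \<open>ords\<close>, which are
  still \<open>undefined\<close> for all other nodes.\<close>

inductive algorithm_state ::
    "'a set \<Rightarrow> ('a \<times> 'a) set \<Rightarrow> 'a list \<Rightarrow> ('a \<Rightarrow> 'a rel) \<Rightarrow> bool"
  for V E where
  init: "algorithm_state V E [] (\<lambda>_. undefined)"
| visit: "algorithm_state V E vs ords \<Longrightarrow> v \<in> V - set vs \<Longrightarrow> pa E v \<subseteq> set vs \<Longrightarrow>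
          partial_order_reachable V E ords v os \<Longrightarrow> length os = card (pa E v) \<Longrightarrow>
          algorithm_state V E (vs @ [v]) (ords(v := order_of_list os))"

definition algorithm_outputs :: "'a set \<Rightarrow> ('a \<times> 'a) set \<Rightarrow> ('a \<Rightarrow> 'a rel) set" where
  "algorithm_outputs V E = {ords. \<exists>vs. set vs = V \<and> algorithm_state V E vs ords}"

end

theory Submission
  imports Defs
begin

text \<open>The margin \<open>u\<^bsub>v|pa(v\<down>w)\<^esub>\<close> can be computed by removing the parents of \<open>v\<close> from the largest to
  the smallest: each removal uses a copula of the model, which is specified, and a margin
  \<open>u\<^bsub>k|pa(v\<down>k)\<^esub>\<close> with \<open>k <\<^sub>v w\<close>. Hence only the margins \<open>u\<^bsub>w|pa(v\<down>w)\<^esub>\<close> matter, and these are exactly what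
  the algorithm tests. Since every copula in a recursion of \<open>u\<^bsub>w|K\<^esub>\<close> is on a pair from \<open>K \<union> {w}\<close>, the
  test at \<open>v\<close> depends only on the orders at the parents of \<open>v\<close>, so that it does not
  matter whether it is done with the orders chosen so far or with the final ones.\<close>

section \<open>Dependence of margins on the parental orders\<close>

lemma copulas_of_recursion:
  assumes "is_recursion v K R" and "(a, b, C) \<in> copulas R"
  shows "a \<in> insert v K \<and> b \<in> insert v K"
  using assms by induction auto

text \<open>The orders enter only through \<open>pa_below\<close> at the two nodes of the pair;
  d-separation sees the graph alone.\<close>

lemma specified_cong:
  assumes "ords w = ords' w" and "ords v = ords' v"
  shows "specified V E ords w v K \<longleftrightarrow> specified V E ords' w v K"
  using assms by (simp add: specified_def specified_directed_def pa_below_def)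

lemma margin_requires_integration_cong:
  assumes "\<And>x. x \<in> insert v K \<Longrightarrow> ords x = ords' x"
  shows "margin_requires_integration V E ords v K \<longleftrightarrow> margin_requires_integration V E ords' v K"
proof -
  have "proper V E ords R \<longleftrightarrow> proper V E ords' R" if R: "is_recursion v K R" for R
  proof -
    have "specified V E ords a b C \<longleftrightarrow> specified V E ords' a b C" if "(a, b, C) \<in> copulas R" for a b C
      using copulas_of_recursion[OF R that] assms by (intro specified_cong) blast+
    then show ?thesis
      unfolding proper_def by fast
  qed
  then show ?thesis
    unfolding margin_requires_integration_def recursions_def by blast
qed

lemma margin_computable_empty: "\<not> margin_requires_integration V E ords v {}"
  unfolding margin_requires_integration_def recursions_def proper_def
  by (auto intro: is_recursion.base exI[of _ "Base v"])

lemma margin_computable_step: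
  assumes "k \<in> K" and "specified V E ords v k (K - {k})"
    and "\<not> margin_requires_integration V E ords v (K - {k})"
    and "\<not> margin_requires_integration V E ords k (K - {k})"
  shows "\<not> margin_requires_integration V E ords v K"
proof -
  obtain Rv Rk where R: "is_recursion v (K - {k}) Rv" "proper V E ords Rv"
      "is_recursion k (K - {k}) Rk" "proper V E ords Rk"
    using assms(3,4) by (auto simp: margin_requires_integration_def recursions_def)
  let ?R = "Step (v, K) k (v, k, K - {k}) Rv Rk"
  have "is_recursion v K ?R"
    using assms(1) R by (intro is_recursion.step)
  moreover have "proper V E ords ?R"
    using assms(2) R by (auto simp: proper_def)
  ultimately show ?thesis
    by (auto simp: margin_requires_integration_def recursions_def)
qed

section \<open>Choices of the algorithm at a fixed node\<close>

text \<open>When \<open>os ! k\<close> is chosen, the current partial order is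
  \<open>take k os\<close>, so the inductive process unfolds into one test per index.\<close>

lemma partial_order_reachable_iff:
  assumes "finite (pa E v)"
  shows "partial_order_reachable V E ords v os \<longleftrightarrow>
    distinct os \<and> set os \<subseteq> pa E v \<and>
    (\<forall>k < length os. \<not> margin_requires_integration V E ords (os ! k) (set (take k os)))"
    (is "_ \<longleftrightarrow> ?P os")
proof
  assume "partial_order_reachable V E ords v os"
  then show "?P os"
    by induction (auto simp: poss_cand_def nth_append less_Suc_eq)
next
  show "?P os \<Longrightarrow> partial_order_reachable V E ords v os"
  proof (induction os rule: rev_induct)
    case Nil
    show ?case by (rule partial_order_reachable.start)
  next
    case (snoc w os)
    have *: "\<not> margin_requires_integration V E ords ((os @ [w]) ! k) (set (take k (os @ [w])))"
      if "k < Suc (length os)" for k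
      using snoc.prems that by auto
    have "\<not> margin_requires_integration V E ords (os ! k) (set (take k os))" if "k < length os" for k
      using *[of k] that by (simp add: nth_append)
    then have "partial_order_reachable V E ords v os"
      using snoc by auto
    moreover have "length os < card (pa E v)"
      using snoc.prems assms card_mono[of "pa E v" "set (os @ [w])"] distinct_card[of "os @ [w]"]
      by auto
    moreover have "w \<in> poss_cand V E ords v os"
      using snoc.prems *[of "length os"] by (auto simp: poss_cand_def)
    ultimately show ?case
      by (rule partial_order_reachable.extend)
  qed
qed

text \<open>Every test at \<open>v\<close> concerns a margin among parents of \<open>v\<close>; in a
  DAG the order at \<open>v\<close> itself, still being built, may therefore differ.\<close>

lemma partial_order_reachable_cong:
  assumes fin: "finite (pa E v)" and eq: "\<And>x. x \<in> pa E v \<Longrightarrow> ords x = ords' x"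
  shows "partial_order_reachable V E ords v os \<longleftrightarrow> partial_order_reachable V E ords' v os"
proof -
  have "margin_requires_integration V E ords (os ! k) (set (take k os)) \<longleftrightarrow>
      margin_requires_integration V E ords' (os ! k) (set (take k os))"
    if "set os \<subseteq> pa E v" "k < length os" for k
    using that by (intro margin_requires_integration_cong eq) (auto dest: in_set_takeD)
  then show ?thesis
    unfolding partial_order_reachable_iff[OF fin] by blast
qed

section \<open>Lists and strict linear orders\<close>

text \<open>By distinctness \<open>os ! k\<close> has no index but \<open>k\<close>, so its
  predecessors form a prefix. This later identifies \<open>pa_below\<close> with a partial order of
  the algorithm.\<close>

lemma in_order_of_list_iff:
  assumes "distinct os" and "k < length os"
  shows "(z, os ! k) \<in> order_of_list os \<longleftrightarrow> z \<in> set (take k os)"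
proof
  assume "(z, os ! k) \<in> order_of_list os"
  then obtain i j where "i < j" "j < length os" "z = os ! i" "os ! k = os ! j"
    by (auto simp: order_of_list_def)
  moreover from this have "j = k"
    using assms by (simp add: nth_eq_iff_index_eq)
  ultimately show "z \<in> set (take k os)"
    by (auto simp: in_set_conv_nth)
next
  assume "z \<in> set (take k os)"
  then show "(z, os ! k) \<in> order_of_list os"
    using assms by (auto simp: order_of_list_def in_set_conv_nth)
qed

lemma order_of_list_snoc: "order_of_list (os @ [m]) = order_of_list os \<union> set os \<times> {m}"
proof (intro subset_antisym subrelI)
  fix a b assume "(a, b) \<in> order_of_list (os @ [m])"
  then obtain i j where ij: "i < j" "j < Suc (length os)" "a = (os @ [m]) ! i" "b = (os @ [m]) ! j"
    by (auto simp: order_of_list_def)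
  show "(a, b) \<in> order_of_list os \<union> set os \<times> {m}"
  proof (cases "j < length os")
    case True
    then show ?thesis
      using ij by (auto simp: order_of_list_def nth_append)
  next
    case False
    then have "j = length os"
      using ij by simp
    then show ?thesis
      using ij by (simp add: nth_append)
  qed
next
  fix a b assume "(a, b) \<in> order_of_list os \<union> set os \<times> {m}"
  then consider i j where "i < j" "j < length os" "a = os ! i" "b = os ! j"
    | i where "i < length os" "a = os ! i" "b = m"
    by (auto simp: order_of_list_def in_set_conv_nth)
  then show "(a, b) \<in> order_of_list (os @ [m])"
  proof cases
    case 1
    then show ?thesis
      unfolding order_of_list_def by (intro CollectI exI[of _ i] exI[of _ j]) (simp add: nth_append)
  next
    case 2
    then show ?thesis
      unfolding order_of_list_def
      by (intro CollectI exI[of _ i] exI[of _ "length os"]) (simp add: nth_append)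
  qed
qed

text \<open>Induction on the cardinality: the greatest element is appended to a list of the others.
  The relation stays fixed while \<open>A\<close> shrinks, hence the restriction to
  \<open>A \<times> A\<close>.\<close>

lemma strict_linear_order_on_list:
  assumes "finite A" and "strict_linear_order_on A r"
  shows "\<exists>os. distinct os \<and> set os = A \<and> order_of_list os = r \<inter> A \<times> A"
  using assms
proof (induction "card A" arbitrary: A)
  case 0
  then show ?case
    by (intro exI[of _ "[]"]) (auto simp: order_of_list_def)
next
  case (Suc n)
  have r: "trans r" "irrefl r" "total_on A r"
    using Suc.prems by (auto simp: strict_linear_order_on_def)
  have "trans (r \<inter> A \<times> A)"
    using r(1) by (auto simp: trans_def)
  then have "acyclic (r \<inter> A \<times> A)"
    using r(2) by (auto simp: acyclic_irrefl irrefl_def)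
  \<comment> \<open>A minimal element for the converse is a maximal one; totality then makes it the
    greatest.\<close>
  then have "wf ((r \<inter> A \<times> A)\<inverse>)"
    using Suc.prems by (intro finite_acyclic_wf_converse) auto
  moreover have "A \<noteq> {}"
    using Suc.hyps by auto
  ultimately obtain m where m: "m \<in> A" "\<And>y. (y, m) \<in> (r \<inter> A \<times> A)\<inverse> \<Longrightarrow> y \<notin> A"
    by (meson ex_in_conv wfE_min)
  have max: "(y, m) \<in> r \<and> (m, y) \<notin> r" if "y \<in> A" "y \<noteq> m" for y
    using that m r(3) unfolding total_on_def by blast
  have n: "n = card (A - {m})"
    using Suc.hyps(2) Suc.prems(1) m(1) by simp
  have "strict_linear_order_on (A - {m}) r"
    using r by (auto simp: strict_linear_order_on_def total_on_def)
  then obtain os where os: "distinct os" "set os = A - {m}"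
      "order_of_list os = r \<inter> (A - {m}) \<times> (A - {m})"
    using Suc.hyps(1)[OF n] Suc.prems(1) by auto
  have "order_of_list (os @ [m]) = r \<inter> A \<times> A"
    using os(2,3) max m(1) r(2) by (auto simp: order_of_list_snoc irrefl_def)
  then show ?case
    using os m(1) by (intro exI[of _ "os @ [m]"]) auto
qed

section \<open>Computable margins and the algorithm at one node\<close>

text \<open>All tests are evaluated in the one family \<open>ords\<close>, which may be the final
  one, so that the condition does not refer to the moment when \<open>v\<close> is visited.\<close>

definition reachable_order ::
    "'a set \<Rightarrow> ('a \<times> 'a) set \<Rightarrow> ('a \<Rightarrow> 'a rel) \<Rightarrow> 'a \<Rightarrow> bool" where
  "reachable_order V E ords v \<longleftrightarrow> (\<exists>os. length os = card (pa E v) \<and>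
     partial_order_reachable V E ords v os \<and> ords v = order_of_list os)"

lemma dag_finite_pa: "dag V E \<Longrightarrow> finite (pa E v)"
  by (rule finite_subset[of _ V]) (auto simp: dag_def pa_def)

lemma no_integration_at_node_iff:
  assumes dag: "dag V E" and ords: "ords \<in> parental_orders V E" and v: "v \<in> V"
  shows "(\<forall>w \<in> pa E v.
      \<not> margin_requires_integration V E ords w (pa_below E ords v w) \<and>
      \<not> margin_requires_integration V E ords v (pa_below E ords v w)) \<longleftrightarrow>
    reachable_order V E ords v" (is "?L \<longleftrightarrow> _")
proof -
  have fin: "finite (pa E v)"
    using dag by (rule dag_finite_pa)
  have below: "pa_below E ords v (os ! k) = set (take k os)"
    if "distinct os" "set os = pa E v" "ords v = order_of_list os" "k < length os" for os k
    using that by (auto simp: pa_below_def in_order_of_list_iff dest: in_set_takeD)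
  show ?thesis
  proof
    assume L: ?L
    have "ords v \<subseteq> pa E v \<times> pa E v" "strict_linear_order_on (pa E v) (ords v)"
      using ords v by (auto simp: parental_orders_def PiE_def Pi_def)
    then obtain os where os: "distinct os" "set os = pa E v" "ords v = order_of_list os"
      using strict_linear_order_on_list[OF fin, of "ords v"] by auto
    have "partial_order_reachable V E ords v os"
      unfolding partial_order_reachable_iff[OF fin]
    proof (intro conjI allI impI)
      show "\<not> margin_requires_integration V E ords (os ! k) (set (take k os))" if "k < length os" for k
        using L below[OF os that] nth_mem[OF that] os(2) by auto
    qed (use os in auto)
    then show "reachable_order V E ords v"
      using os distinct_card[of os] by (auto simp: reachable_order_def)
  next
    assume "reachable_order V E ords v"
    then obtain os where len: "length os = card (pa E v)"
      and reach: "partial_order_reachable V E ords v os" and eq: "ords v = order_of_list os"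
      by (auto simp: reachable_order_def)
    have dist: "distinct os" and sub: "set os \<subseteq> pa E v"
      and computable:
        "\<And>k. k < length os \<Longrightarrow> \<not> margin_requires_integration V E ords (os ! k) (set (take k os))"
      using reach by (auto simp: partial_order_reachable_iff[OF fin])
    have set: "set os = pa E v"
      using card_subset_eq[OF fin sub] distinct_card[OF dist] len by simp
    note below = below[OF dist set eq]
    \<comment> \<open>The largest parent \<open>os ! k\<close> of the prefix is removed. What
      remains is a margin of \<open>v\<close>, covered by the induction hypothesis, and the margin
      of \<open>os ! k\<close> that the algorithm has tested.\<close>
    have child: "\<not> margin_requires_integration V E ords v (set (take k os))" if "k \<le> length os" for k
      using that
    proof (induction k)
      case 0
      then show ?case by (simp add: margin_computable_empty)
    next
      case (Suc k)
      then have k: "k < length os" by simp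
      have notin: "os ! k \<notin> set (take k os)"
        using dist k by (auto simp: in_set_conv_nth nth_eq_iff_index_eq)
      have diff: "set (take (Suc k) os) - {os ! k} = set (take k os)"
        using notin k by (simp add: take_Suc_conv_app_nth)
      have arc: "(os ! k, v) \<in> E"
        using set k nth_mem[of k os] by (auto simp: pa_def)
      have "set (take k os) \<subseteq> pa E v"
        using set by (auto dest: in_set_takeD)
      moreover have "v \<notin> pa E v" "pa E v \<subseteq> V"
        using dag by (auto simp: dag_def pa_def acyclic_def)
      \<comment> \<open>\<open>specified\<close> admits both namings of the pair: for the arc from
        \<open>os ! k\<close> to \<open>v\<close> the conditioning set is exactly
        \<open>pa_below\<close>, so case (i) applies.\<close>
      ultimately have spec: "specified V E ords v (os ! k) (set (take k os))"
        unfolding specified_def specified_directed_def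
        using v arc notin below[OF k] by (auto simp: pa_def)
      show ?case
        by (rule margin_computable_step[where k = "os ! k"])
          (use spec Suc.IH computable[OF k] k diff in \<open>simp_all add: take_Suc_conv_app_nth[of k os]\<close>)
    qed
    show ?L
    proof
      fix w assume "w \<in> pa E v"
      then obtain k where "k < length os" "w = os ! k"
        using set by (metis in_set_conv_nth)
      then show "\<not> margin_requires_integration V E ords w (pa_below E ords v w) \<and>
          \<not> margin_requires_integration V E ords v (pa_below E ords v w)"
        using computable child[of k] by (simp add: below)
    qed
  qed
qed

section \<open>Runs of the algorithm through all nodes\<close>

text \<open>The visited set stays closed under parents, so giving a new node its order changes no
  earlier test.\<close>

lemma algorithm_state_reachable:
  assumes "algorithm_state V E vs ords" and dag: "dag V E"
  shows "\<forall>v \<in> set vs. pa E v \<subseteq> set vs \<and> reachable_order V E ords v"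
  using assms(1)
proof induction
  case init
  then show ?case by simp
next
  case (visit vs ords v os)
  let ?ords' = "ords(v := order_of_list os)"
  have new: "v \<notin> set vs"
    using visit.hyps by simp
  \<comment> \<open>This serves for \<open>v\<close> and for the earlier nodes alike, since
    \<open>v\<close> is a parent of none of them.\<close>
  have cong: "partial_order_reachable V E ?ords' x = partial_order_reachable V E ords x"
    if "pa E x \<subseteq> set vs" for x
    using that new by (intro ext partial_order_reachable_cong dag_finite_pa[OF dag]) auto
  have "reachable_order V E ?ords' v"
    using visit.hyps cong[of v] by (auto simp: reachable_order_def)
  moreover have "reachable_order V E ?ords' x" if "x \<in> set vs" for x
    using visit.IH that new cong[of x] by (auto simp: reachable_order_def)
  ultimately show ?case
    using visit.IH visit.hyps by (simp del: fun_upd_apply) blast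
qed

text \<open>A topological order is built one node at a time; the state reached is
  \<open>ords\<close> cut off outside the visited nodes, where the algorithm still has
  \<open>undefined\<close>.\<close>

lemma reachable_algorithm_state:
  assumes dag: "dag V E" and reach: "\<And>v. v \<in> V \<Longrightarrow> reachable_order V E ords v"
    and "n \<le> card V"
  shows "\<exists>vs. length vs = n \<and> distinct vs \<and> set vs \<subseteq> V \<and>
    algorithm_state V E vs (\<lambda>v. if v \<in> set vs then ords v else undefined)"
  using assms(3)
proof (induction n)
  case 0
  then show ?case by (auto intro: algorithm_state.init)
next
  case (Suc n)
  then obtain vs where vs: "length vs = n" "distinct vs" "set vs \<subseteq> V"
    and state: "algorithm_state V E vs (\<lambda>v. if v \<in> set vs then ords v else undefined)"
      (is "algorithm_state V E vs ?ords")
    by auto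
  have "finite V" and E: "E \<subseteq> V \<times> V" and "acyclic E"
    using dag by (auto simp: dag_def)
  then have "wf E"
    by (meson finite_SigmaI finite_acyclic_wf finite_subset)
  moreover have "V - set vs \<noteq> {}"
    using Suc.prems vs distinct_card[of vs] by auto
  \<comment> \<open>An \<open>E\<close>-minimal unvisited node has all its parents visited and can
    come next.\<close>
  ultimately obtain v where v: "v \<in> V - set vs" "\<And>y. (y, v) \<in> E \<Longrightarrow> y \<notin> V - set vs"
    by (meson ex_in_conv wfE_min)
  then have pa: "pa E v \<subseteq> set vs"
    using E by (auto simp: pa_def)
  obtain os where os: "length os = card (pa E v)" "partial_order_reachable V E ords v os"
      "ords v = order_of_list os"
    using reach[of v] v by (auto simp: reachable_order_def)
  \<comment> \<open>The cut-off family agrees with \<open>ords\<close> at the parents of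
    \<open>v\<close>, which is all the tests read.\<close>
  have "partial_order_reachable V E ?ords v os"
    using os(2) pa
    by (subst partial_order_reachable_cong[OF dag_finite_pa[OF dag], where ords' = ords]) auto
  then have "algorithm_state V E (vs @ [v]) (?ords(v := order_of_list os))"
    using state v pa os by (intro algorithm_state.visit)
  moreover have "?ords(v := order_of_list os) =
      (\<lambda>x. if x \<in> set (vs @ [v]) then ords x else undefined)"
    using os(3) by (intro ext) simp
  ultimately show ?case
    using vs v by (intro exI[of _ "vs @ [v]"]) auto
qed

text \<open>After a full run the cut-off happens only outside \<open>V\<close>, where
  \<open>undef\<close> makes it agree with \<open>ords\<close>.\<close>

lemma algorithm_outputs_iff:
  assumes dag: "dag V E" and undef: "\<And>v. v \<notin> V \<Longrightarrow> ords v = undefined"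
  shows "ords \<in> algorithm_outputs V E \<longleftrightarrow> (\<forall>v \<in> V. reachable_order V E ords v)"
proof
  assume "ords \<in> algorithm_outputs V E"
  then show "\<forall>v \<in> V. reachable_order V E ords v"
    using algorithm_state_reachable[OF _ dag] by (auto simp: algorithm_outputs_def)
next
  assume "\<forall>v \<in> V. reachable_order V E ords v"
  then obtain vs where vs: "length vs = card V" "distinct vs" "set vs \<subseteq> V"
      "algorithm_state V E vs (\<lambda>v. if v \<in> set vs then ords v else undefined)"
    using reachable_algorithm_state[OF dag, of ords "card V"] by auto
  moreover from this have "set vs = V"
    using dag distinct_card[of vs] by (intro card_subset_eq) (auto simp: dag_def)
  moreover from this have "(\<lambda>v. if v \<in> set vs then ords v else undefined) = ords"
    using undef by (intro ext) simp
  ultimately show "ords \<in> algorithm_outputs V E"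
    by (auto simp: algorithm_outputs_def)
qed

theorem theorem4p2:
  fixes V :: "'a set" and E :: "('a \<times> 'a) set" and P :: "'a pcbn_data"
  assumes "dag V E"
    and "\<not> has_active_cycle V E"
    and "\<not> has_interfering_v_structures V E"
    and "pcbn V E P"
  shows "\<not> joint_density_requires_integration V E P \<longleftrightarrow> orders P \<in> algorithm_outputs V E"
proof -
  have ords: "orders P \<in> parental_orders V E"
    using assms(4) by (simp add: pcbn_def)
  \<comment> \<open>Extensionality of parental orders matches the default value from which the
    algorithm starts.\<close>
  then have undef: "orders P v = undefined" if "v \<notin> V" for v
    using that by (auto simp: parental_orders_def PiE_def extensional_def)
  have "orders P \<in> algorithm_outputs V E \<longleftrightarrow> (\<forall>v \<in> V. reachable_order V E (orders P) v)"
    using assms(1) undef by (rule algorithm_outputs_iff)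
  then show ?thesis
    using no_integration_at_node_iff[OF assms(1) ords]
    unfolding joint_density_requires_integration_def by blast
qed

end
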